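(* Let $C_n$ denote the cycle of order $n$ and $W_n$ the wheel obtained from $C_n$ by joining a new vertex to every vertex of $C_n$ ($n\geq 3$). Then: (a) $pvc(W_3)=0$ and $pvc(W_n)=1$ for all $n\geq 4$. (b) $pvc_2(W_3)=1$ and $pvc_2(W_n)=pvc(C_n)$ for all $n\geq 4$. (c) $pvc_3(W_3)=1$ and $pvc_3(W_n)=pvc_2(C_n)$ for all $n\geq 4$.
   Context: All graphs are simple, finite and undirected. Vertex-colorings are arbitrary (adjacent vertices may receive the same color). A path in a vertex-colored graph is a vertex-proper path if any two adjacent internal vertices of the path differ in color (the end-vertices of the path are not internal). A set of internally vertex-disjoint paths is called disjoint. A vertex-colored graph is proper vertex $k$-connected if any two distinct vertices are connected by $k$ (distinct) disjoint vertex-proper paths. For a $k$-connected graph $G$, $pvc_k(G)$ is the smallest number of colors required to make $G$ proper vertex $k$-connected; $pvc(G)=pvc_1(G)$. The value $0$ is allowed: it means that no vertex needs to be colored, where an uncolored path counts as vertex-proper exactly when it has no internal vertices. *)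

theory Defs
  imports "Graph_Theory.Graph_Theory"
begin

(* A simple finite undirected graph is a pair_graph: finite, loop-free, with a symmetric set of
   arcs, so that the undirected edge uv is represented by the two arcs (u,v) and (v,u). *)

definition cycle_graph :: "nat \<Rightarrow> nat pair_pre_digraph" where
  "cycle_graph n = \<lparr> pverts = {0..<n},
     parcs = {(i, j). i < n \<and> j < n \<and> (j = (i + 1) mod n \<or> i = (j + 1) mod n)} \<rparr>"

(* None is the new vertex, joined to every vertex of G. *)
definition join_vertex :: "'a pair_pre_digraph \<Rightarrow> 'a option pair_pre_digraph" where
  "join_vertex G = \<lparr> pverts = insert None (Some ` pverts G),
     parcs = map_prod Some Some ` parcs G
       \<union> {None} \<times> Some ` pverts G \<union> Some ` pverts G \<times> {None} \<rparr>"

definition wheel_graph :: "nat \<Rightarrow> nat option pair_pre_digraph" where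
  "wheel_graph n = join_vertex (cycle_graph n)"

lemma pair_graph_cycle_graph: "n \<ge> 3 \<Longrightarrow> pair_graph (cycle_graph n)"
proof
  show "finite (parcs (cycle_graph n))"
    by (rule finite_subset[of _ "{0..<n} \<times> {0..<n}"]) (auto simp: cycle_graph_def)
  show "fst e \<noteq> snd e" if "n \<ge> 3" "e \<in> parcs (cycle_graph n)" for e
  proof -
    have "Suc i mod n \<noteq> i" if "i < n" for i
      using \<open>n \<ge> 3\<close> that by (cases "Suc i = n") auto
    then show ?thesis using that by (force simp: cycle_graph_def)
  qed
qed (auto simp: cycle_graph_def symmetric_def intro!: symI)

lemma pair_graph_join_vertex:
  assumes "pair_graph G"
  shows "pair_graph (join_vertex G)"
proof -
  interpret pair_graph G by fact
  have "(v, u) \<in> parcs G" if "(u, v) \<in> parcs G" for u v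
    using pair_sym_arcs that by (auto simp: symmetric_def dest: symD)
  then have "sym (parcs (join_vertex G))"
    by (intro symI) (auto simp: join_vertex_def)
  moreover have "finite (pverts (join_vertex G))" "finite (parcs (join_vertex G))"
    using pair_finite_verts pair_finite_arcs by (auto simp: join_vertex_def)
  ultimately show ?thesis
    by unfold_locales
      (auto simp: join_vertex_def symmetric_def dest: arc_fst_in_verts arc_snd_in_verts pair_no_loops)
qed

lemma pair_graph_wheel_graph: "n \<ge> 3 \<Longrightarrow> pair_graph (wheel_graph n)"
  by (simp add: wheel_graph_def pair_graph_cycle_graph pair_graph_join_vertex)

definition path_between :: "'a pair_pre_digraph \<Rightarrow> 'a \<Rightarrow> 'a \<Rightarrow> 'a list \<Rightarrow> bool" where
  "path_between G u v p \<longleftrightarrow> vpath p (with_proj G) \<and> hd p = u \<and> last p = v"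

definition internal_vertices :: "'a list \<Rightarrow> 'a list" where
  "internal_vertices p = butlast (tl p)"

(* Colors are 0, ..., m - 1. With m > 0 every vertex is colored, and adjacent vertices may receive
   the same color; with m = 0 every vertex is uncolored (mapped to None). *)
definition vertex_coloring :: "'a pair_pre_digraph \<Rightarrow> nat \<Rightarrow> ('a \<Rightarrow> nat option) \<Rightarrow> bool" where
  "vertex_coloring G m c \<longleftrightarrow> dom c = (if m = 0 then {} else pverts G) \<and> ran c \<subseteq> {..<m}"

(* Without colors, exactly the paths without internal vertices are vertex-proper. The condition
   on dom c is void for the paths of G under a coloring with m > 0. distinct_adj compares
   consecutive list elements, i.e. vertices adjacent on the path. *)
definition vertex_proper :: "('a \<Rightarrow> nat option) \<Rightarrow> 'a list \<Rightarrow> bool" where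
  "vertex_proper c p \<longleftrightarrow>
     set (internal_vertices p) \<subseteq> dom c \<and> distinct_adj (map c (internal_vertices p))"

definition disjoint_paths :: "'a list set \<Rightarrow> bool" where
  "disjoint_paths P \<longleftrightarrow>
     pairwise (\<lambda>p q. set (internal_vertices p) \<inter> set (internal_vertices q) = {}) P"

definition proper_vertex_connected ::
    "nat \<Rightarrow> 'a pair_pre_digraph \<Rightarrow> ('a \<Rightarrow> nat option) \<Rightarrow> bool" where
  "proper_vertex_connected k G c \<longleftrightarrow>
     (\<forall>u\<in>pverts G. \<forall>v\<in>pverts G. u \<noteq> v \<longrightarrow>
        (\<exists>P. finite P \<and> card P = k \<and> disjoint_paths P \<and>
             (\<forall>p\<in>P. path_between G u v p \<and> vertex_proper c p)))"

(* Only meaningful for k-connected G. *)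
definition pvc_k :: "nat \<Rightarrow> 'a pair_pre_digraph \<Rightarrow> nat" where
  "pvc_k k G = (LEAST m. \<exists>c. vertex_coloring G m c \<and> proper_vertex_connected k G c)"

abbreviation pvc :: "'a pair_pre_digraph \<Rightarrow> nat" where
  "pvc G \<equiv> pvc_k 1 G"

end

(* A path between two vertices of G that passes through the hub of the join of G with a new vertex
   occupies the hub internally, so a disjoint family contains at most one such path: deleting it
   leaves paths of G, and conversely the path through the hub can be added to any family in G.
   Hence, as long as every vertex of G has k neighbours (which handle the pairs containing the hub)
   and G is not complete (which excludes the uncolored case), k + 1 disjoint proper paths in the
   join are available with m colors iff k are available in G.
   The wheel W_3 is complete and is treated separately. *)

theory Submission
  imports Defs
begin

section \<open>Families of disjoint proper paths between two vertices\<close>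

definition proper_path_family ::
    "'a pair_pre_digraph \<Rightarrow> ('a \<Rightarrow> nat option) \<Rightarrow> 'a \<Rightarrow> 'a \<Rightarrow> 'a list set \<Rightarrow> bool" where
  "proper_path_family G c u v P \<longleftrightarrow>
     finite P \<and> disjoint_paths P \<and> (\<forall>p\<in>P. path_between G u v p \<and> vertex_proper c p)"

text \<open>Keeps the size of a family apart from the conditions on its members, so that adding or
  deleting one path changes only \<open>card\<close>.\<close>

lemma proper_vertex_connected_iff:
  "proper_vertex_connected k G c \<longleftrightarrow>
     (\<forall>u\<in>pverts G. \<forall>v\<in>pverts G. u \<noteq> v \<longrightarrow> (\<exists>P. proper_path_family G c u v P \<and> card P = k))"
  unfolding proper_vertex_connected_def proper_path_family_def
  by (intro ball_cong imp_cong ex_cong1 refl) auto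

lemma vwalk_arcs_map: "vwalk_arcs (map f p) = map (map_prod f f) (vwalk_arcs p)"
  by (induction p rule: vwalk_arcs.induct) auto

lemma internal_vertices_map: "internal_vertices (map f p) = map f (internal_vertices p)"
  by (simp add: internal_vertices_def map_butlast map_tl)

lemma vertex_proper_map: "vertex_proper c (map f p) \<longleftrightarrow> vertex_proper (c \<circ> f) p"
  by (auto simp: vertex_proper_def internal_vertices_map dom_def)

lemma disjoint_paths_map:
  assumes "inj f"
  shows "disjoint_paths (map f ` P) \<longleftrightarrow> disjoint_paths P"
proof -
  have "inj (map f)" using assms by (rule list.inj_map)
  then show ?thesis
    using assms unfolding disjoint_paths_def pairwise_def
    by (auto simp: internal_vertices_map inj_eq simp flip: image_Int)
qed

lemma disjoint_paths_insert:
  assumes "disjoint_paths P"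
    and "\<And>p. p \<in> P \<Longrightarrow> set (internal_vertices q) \<inter> set (internal_vertices p) = {}"
  shows "disjoint_paths (insert q P)"
  using assms unfolding disjoint_paths_def by (auto simp: pairwise_insert)

text \<open>Distinct ends exclude the one-vertex path, the only path whose first and last entries
  are the same list position. This recovers a path from its internal vertices.\<close>

lemma path_between_eq_append:
  assumes "path_between G u v p" "u \<noteq> v"
  shows "p = u # internal_vertices p @ [v]"
proof (cases p)
  case (Cons a q)
  then show ?thesis
    using assms by (cases q rule: rev_cases)
      (auto simp: path_between_def internal_vertices_def)
qed (use assms in \<open>auto simp: path_between_def vpath_def vwalk_def\<close>)

lemma internal_vertices_edge: "internal_vertices [u, v] = []"
  and internal_vertices_two_edges: "internal_vertices [u, w, v] = [w]"
  by (simp_all add: internal_vertices_def)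

section \<open>Connection without colors and with a single color\<close>

lemma uncolored_proper_path:
  assumes "path_between G u v p" "vertex_proper Map.empty p" "u \<noteq> v"
  shows "p = [u, v]"
  using path_between_eq_append[OF assms(1,3)] assms(2) by (simp add: vertex_proper_def)

text \<open>Only an edge is proper without colors, so a single nonadjacent pair is an obstruction;
  \<open>0 < k\<close> ensures that its family has a member at all.\<close>

lemma not_proper_vertex_connected_uncolored:
  assumes "u \<in> pverts G" "v \<in> pverts G" "u \<noteq> v" "(u, v) \<notin> parcs G" "0 < k"
  shows "\<not> proper_vertex_connected k G Map.empty"
proof
  assume "proper_vertex_connected k G Map.empty"
  then obtain P where P: "proper_path_family G Map.empty u v P" "card P = k"
    using assms by (auto simp: proper_vertex_connected_iff)
  then obtain p where "p \<in> P" using \<open>0 < k\<close> by fastforce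
  then have "path_between G u v p" "vertex_proper Map.empty p"
    using P by (auto simp: proper_path_family_def)
  then show False
    using uncolored_proper_path[of G u v p] assms
    by (auto simp: path_between_def vpath_def vwalk_def)
qed

lemma vertex_coloring_0: "vertex_coloring G 0 c \<longleftrightarrow> c = Map.empty"
  by (auto simp: vertex_coloring_def)

lemma pvc_k_eq_0:
  assumes "proper_vertex_connected k G Map.empty"
  shows "pvc_k k G = 0"
  unfolding pvc_k_def
  by (intro Least_eq_0 exI[of _ Map.empty] conjI assms) (simp add: vertex_coloring_0)

lemma pvc_k_eq_1:
  assumes "\<not> proper_vertex_connected k G Map.empty"
    and "vertex_coloring G 1 c" "proper_vertex_connected k G c"
  shows "pvc_k k G = 1"
  unfolding pvc_k_def
proof (rule Least_equality)
  fix m assume "\<exists>c. vertex_coloring G m c \<and> proper_vertex_connected k G c"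
  then obtain d where "vertex_coloring G m d" "proper_vertex_connected k G d" by blast
  then have "m \<noteq> 0" using assms(1) by (cases "m = 0") (simp_all add: vertex_coloring_0)
  then show "1 \<le> m" by simp
qed (intro exI[of _ c] conjI assms(2,3))

text \<open>Undefined outside the graph, because \<open>vertex_coloring\<close> asks for a domain
  equal to \<open>pverts G\<close>.\<close>

definition constant_coloring :: "'a pair_pre_digraph \<Rightarrow> 'a \<Rightarrow> nat option" where
  "constant_coloring G v = (if v \<in> pverts G then Some 0 else None)"

lemma vertex_coloring_constant: "vertex_coloring G 1 (constant_coloring G)"
  by (auto simp: vertex_coloring_def constant_coloring_def dom_def ran_def split: if_splits)

lemma dom_constant_coloring: "dom (constant_coloring G) = pverts G"
  by (auto simp: constant_coloring_def dom_def)

section \<open>Paths with at most two edges, and complete graphs\<close>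

context pair_graph
begin

lemma path_between_edge:
  assumes "(u, v) \<in> parcs G"
  shows "path_between G u v [u, v]" "vertex_proper c [u, v]"
  using assms arc_fst_in_verts[OF assms] arc_snd_in_verts[OF assms] pair_no_loops[OF assms]
  by (auto simp: path_between_def vpath_def vwalk_def vertex_proper_def internal_vertices_edge)

lemma path_between_two_edges:
  assumes "(u, w) \<in> parcs G" "(w, v) \<in> parcs G" "u \<noteq> v" "w \<in> dom c"
  shows "path_between G u v [u, w, v]" "vertex_proper c [u, w, v]"
  using assms arc_fst_in_verts[OF assms(1)] arc_snd_in_verts[OF assms(1)]
    arc_snd_in_verts[OF assms(2)] pair_no_loops[OF assms(1)] pair_no_loops[OF assms(2)]
  by (auto simp: path_between_def vpath_def vwalk_def vertex_proper_def internal_vertices_two_edges)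

lemma proper_path_family_edge:
  assumes "(u, v) \<in> parcs G"
  shows "proper_path_family G c u v {[u, v]}"
  using path_between_edge[OF assms]
  by (simp add: proper_path_family_def disjoint_paths_def)

text \<open>The family consists of the edge and the two-edge paths through the vertices of
  \<open>N\<close>. No path has two internal vertices, so the colors do not matter as long as
  \<open>N\<close> is colored; different middle vertices make the paths disjoint. This serves both
  complete graphs and the pairs that contain the hub of a join.\<close>

lemma proper_path_family_common_neighbours:
  assumes "(u, v) \<in> parcs G" "finite N"
    and "\<And>w. w \<in> N \<Longrightarrow> (u, w) \<in> parcs G \<and> (w, v) \<in> parcs G \<and> w \<in> dom c"
  shows "\<exists>P. proper_path_family G c u v P \<and> card P = Suc (card N)"
proof -
  let ?M = "(\<lambda>w. [u, w, v]) ` N"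
  have "u \<noteq> v" using pair_no_loops[OF assms(1)] by simp
  have "disjoint_paths ?M"
    by (auto simp: disjoint_paths_def pairwise_def internal_vertices_two_edges)
  then have "disjoint_paths (insert [u, v] ?M)"
    by (rule disjoint_paths_insert) (simp add: internal_vertices_edge)
  then have "proper_path_family G c u v (insert [u, v] ?M)"
    using assms \<open>u \<noteq> v\<close> path_between_edge[OF assms(1)]
    by (auto simp: proper_path_family_def intro!: path_between_two_edges)
  moreover have "card (insert [u, v] ?M) = Suc (card N)"
    using \<open>finite N\<close> by (subst card_insert_disjoint) (auto simp: card_image inj_on_def)
  ultimately show ?thesis by blast
qed

lemma pvc_complete:
  assumes "\<And>u v. u \<in> pverts G \<Longrightarrow> v \<in> pverts G \<Longrightarrow> u \<noteq> v \<Longrightarrow> (u, v) \<in> parcs G"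
  shows "pvc G = 0"
proof (rule pvc_k_eq_0)
  show "proper_vertex_connected 1 G Map.empty"
    unfolding proper_vertex_connected_iff
    using assms proper_path_family_edge by (metis card_1_singleton_iff One_nat_def)
qed

text \<open>Without colors the edge is the only proper path, too few since 2 \<le> \<open>k\<close>.
  With one color, any further vertex is the middle of a proper two-edge path.\<close>

lemma pvc_k_complete:
  assumes complete: "\<And>u v. u \<in> pverts G \<Longrightarrow> v \<in> pverts G \<Longrightarrow> u \<noteq> v \<Longrightarrow> (u, v) \<in> parcs G"
    and k: "2 \<le> k" "k < card (pverts G)"
  shows "pvc_k k G = 1"
proof (rule pvc_k_eq_1[OF _ vertex_coloring_constant])
  show "\<not> proper_vertex_connected k G Map.empty"
  proof
    assume *: "proper_vertex_connected k G Map.empty"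
    obtain u v where uv: "u \<in> pverts G" "v \<in> pverts G" "u \<noteq> v"
      using k card_le_Suc0_iff_eq[OF pair_finite_verts] by force
    obtain P where P: "proper_path_family G Map.empty u v P" "card P = k"
      using * uv by (auto simp: proper_vertex_connected_iff)
    have "P \<subseteq> {[u, v]}"
      using P uv uncolored_proper_path by (fastforce simp: proper_path_family_def)
    then have "card P \<le> 1" using card_mono[of "{[u, v]}" P] by simp
    then show False using P k by simp
  qed
  show "proper_vertex_connected k G (constant_coloring G)"
    unfolding proper_vertex_connected_iff
  proof (intro ballI impI)
    fix u v assume uv: "u \<in> pverts G" "v \<in> pverts G" "u \<noteq> v"
    \<comment> \<open>The edge itself supplies one path, so \<open>k - 1\<close> middle vertices are
      enough.\<close>
    have "k - 1 \<le> card (pverts G - {u, v})"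
      using k uv by (subst card_Diff_subset) auto
    then obtain N where N: "N \<subseteq> pverts G - {u, v}" "card N = k - 1"
      using obtain_subset_with_card_n by metis
    have "\<exists>P. proper_path_family G (constant_coloring G) u v P \<and> card P = Suc (card N)"
      using N uv complete pair_finite_verts
      by (intro proper_path_family_common_neighbours)
        (auto simp: dom_constant_coloring intro: finite_subset)
    then show "\<exists>P. proper_path_family G (constant_coloring G) u v P \<and> card P = k"
      using N k by simp
  qed
qed

end

section \<open>Transfer of path families between a graph and its join with a hub\<close>

lemma parcs_join_vertex [simp]:
  "(Some x, Some y) \<in> parcs (join_vertex G) \<longleftrightarrow> (x, y) \<in> parcs G"
  "(None, Some x) \<in> parcs (join_vertex G) \<longleftrightarrow> x \<in> pverts G"
  "(Some x, None) \<in> parcs (join_vertex G) \<longleftrightarrow> x \<in> pverts G"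
  by (auto simp: join_vertex_def)

lemma pverts_join_vertex: "pverts (join_vertex G) = insert None (Some ` pverts G)"
  by (simp add: join_vertex_def)

lemma path_between_join_vertex:
  "path_between (join_vertex G) (Some u) (Some v) (map Some p) \<longleftrightarrow> path_between G u v p"
\<comment> \<open>\<open>hd\<close> and \<open>last\<close> commute with \<open>map\<close> only on
  nonempty lists; the empty list is a path on neither side.\<close>
proof (cases "p = []")
  case False
  have "set (vwalk_arcs (map Some p)) \<subseteq> parcs (join_vertex G) \<longleftrightarrow> set (vwalk_arcs p) \<subseteq> parcs G"
    by (auto simp: vwalk_arcs_map)
  then show ?thesis
    using False by (auto simp: path_between_def vpath_def vwalk_def distinct_map hd_map last_map
        pverts_join_vertex)
qed (auto simp: path_between_def vpath_def vwalk_def)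

text \<open>\<open>c \<circ> Some\<close> is the coloring that \<open>c\<close> induces on
  \<open>G\<close>. Injectivity of \<open>Some\<close> preserves disjointness, and the equivalence
  is used in both directions: to restrict families that avoid the hub and to lift families of
  \<open>G\<close>.\<close>

lemma proper_path_family_join_vertex:
  "proper_path_family (join_vertex G) c (Some u) (Some v) (map Some ` P) \<longleftrightarrow>
     proper_path_family G (c \<circ> Some) u v P"
  by (simp add: proper_path_family_def path_between_join_vertex vertex_proper_map
      disjoint_paths_map finite_image_iff inj_on_def)

lemma proper_path_family_avoiding_hub:
  assumes P: "proper_path_family (join_vertex G) c (Some u) (Some v) P" "card P = Suc k"
    and "u \<noteq> v"
  shows "\<exists>Q. proper_path_family G (c \<circ> Some) u v Q \<and> card Q = k"
proof -
  have "P \<noteq> {}" using P by auto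
  have disj: "set (internal_vertices p) \<inter> set (internal_vertices q) = {}"
    if "p \<in> P" "q \<in> P" "p \<noteq> q" for p q
    using that P by (auto simp: proper_path_family_def disjoint_paths_def pairwise_def)
  \<comment> \<open>\<open>q\<close> is the path through the hub if there is one, and any member
    otherwise: in both cases exactly one path is lost, which gives the exact size
    \<open>k\<close>.\<close>
  obtain q where q: "q \<in> P" "\<And>p. p \<in> P - {q} \<Longrightarrow> None \<notin> set (internal_vertices p)"
  proof (cases "\<exists>q\<in>P. None \<in> set (internal_vertices q)")
    case True
    then show ?thesis using that disj by blast
  next
    case False
    then show ?thesis using that \<open>P \<noteq> {}\<close> by blast
  qed
  have "P - {q} \<subseteq> range (map Some)"
  proof
    fix p assume p: "p \<in> P - {q}"
    then have "path_between (join_vertex G) (Some u) (Some v) p"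
      using P by (auto simp: proper_path_family_def)
    then have "p = Some u # internal_vertices p @ [Some v]"
      using \<open>u \<noteq> v\<close> by (intro path_between_eq_append) auto
    \<comment> \<open>Both ends have the form \<open>Some\<close>, so a hub that is not internal
      does not occur on the path at all.\<close>
    then have "set p = set (Some u # internal_vertices p @ [Some v])" by (rule arg_cong)
    then have "None \<notin> set p" using q(2)[OF p] by auto
    then have "map Some (map the p) = p"
      unfolding map_map by (intro map_idI) (metis comp_apply option.collapse)
    then show "p \<in> range (map Some)" by (metis rangeI)
  qed
  then obtain Q where Q: "P - {q} = map Some ` Q" by (metis subset_imageE)
  have "proper_path_family (join_vertex G) c (Some u) (Some v) (P - {q})"
    using P by (auto simp: proper_path_family_def disjoint_paths_def intro: pairwise_subset)
  then have "proper_path_family G (c \<circ> Some) u v Q"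
    by (simp add: Q proper_path_family_join_vertex)
  moreover have "card Q = card (P - {q})"
    unfolding Q by (rule card_image[symmetric]) (simp add: inj_on_def)
  ultimately show ?thesis using P q(1) by auto
qed

context pair_graph
begin

interpretation join: pair_graph "join_vertex G"
  by (rule pair_graph_join_vertex) unfold_locales

text \<open>The new path has the hub as its only internal vertex. No path lifted from
  \<open>G\<close> contains the hub, so the new path is disjoint from all of them and different from
  each. Whatever color the hub has, the new path is proper; the hub only has to be colored.\<close>

lemma proper_path_family_through_hub:
  assumes P: "proper_path_family G (c \<circ> Some) u v P"
    and uv: "u \<in> pverts G" "v \<in> pverts G" "u \<noteq> v" and hub: "None \<in> dom c"
  shows "\<exists>Q. proper_path_family (join_vertex G) c (Some u) (Some v) Q \<and> card Q = Suc (card P)"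
proof -
  let ?h = "[Some u, None, Some v]"
  have *: "proper_path_family (join_vertex G) c (Some u) (Some v) (map Some ` P)"
    using P by (simp add: proper_path_family_join_vertex)
  then have "disjoint_paths (insert ?h (map Some ` P))"
    by (intro disjoint_paths_insert)
      (auto simp: proper_path_family_def internal_vertices_two_edges internal_vertices_map)
  moreover have "path_between (join_vertex G) (Some u) (Some v) ?h" "vertex_proper c ?h"
    by (rule join.path_between_two_edges; use uv hub in simp)+
  ultimately have "proper_path_family (join_vertex G) c (Some u) (Some v) (insert ?h (map Some ` P))"
    using * by (auto simp: proper_path_family_def)
  moreover have "card (insert ?h (map Some ` P)) = Suc (card P)"
    using P by (subst card_insert_disjoint)
      (auto simp: proper_path_family_def card_image inj_on_def)
  ultimately show ?thesis by blast
qed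

lemma proper_vertex_connected_join_vertex:
  assumes "proper_vertex_connected (Suc k) (join_vertex G) c"
  shows "proper_vertex_connected k G (c \<circ> Some)"
  unfolding proper_vertex_connected_iff
proof (intro ballI impI)
  fix u v assume "u \<in> pverts G" "v \<in> pverts G" "u \<noteq> v"
  then have "\<exists>P. proper_path_family (join_vertex G) c (Some u) (Some v) P \<and> card P = Suc k"
    using assms by (auto simp: proper_vertex_connected_iff pverts_join_vertex)
  then show "\<exists>P. proper_path_family G (c \<circ> Some) u v P \<and> card P = k"
    using proper_path_family_avoiding_hub \<open>u \<noteq> v\<close> by metis
qed

lemma proper_vertex_connected_join_vertexI:
  assumes conn: "proper_vertex_connected k G (c \<circ> Some)"
    and dom: "dom c = pverts (join_vertex G)"
    and degree: "\<And>u. u \<in> pverts G \<Longrightarrow> k \<le> card {w. (u, w) \<in> parcs G}"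
  shows "proper_vertex_connected (Suc k) (join_vertex G) c"
  unfolding proper_vertex_connected_iff
proof (intro ballI impI)
  have sym: "(b, a) \<in> parcs G" if "(a, b) \<in> parcs G" for a b
    using pair_sym_arcs that by (auto simp: symmetric_def dest: symD)
  have neighbours: "\<exists>N. finite N \<and> card N = k \<and> N \<subseteq> {w. (u, w) \<in> parcs G}"
    if "u \<in> pverts G" for u
    using degree[OF that] by (rule obtain_subset_with_card_n) blast
  \<comment> \<open>The neighbours of \<open>u\<close> in \<open>G\<close> are common neighbours of
    \<open>u\<close> and the hub, so \<open>k\<close> of them and the spoke give
    \<open>Suc k\<close> paths. Connectedness ranges over ordered pairs, hence the two
    orientations.\<close>
  have spoke_in: "\<exists>P. proper_path_family (join_vertex G) c (Some u) None P \<and> card P = Suc k"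
    and spoke_out: "\<exists>P. proper_path_family (join_vertex G) c None (Some u) P \<and> card P = Suc k"
    if u: "u \<in> pverts G" for u
  proof -
    obtain N where N: "finite N" "card N = k" "N \<subseteq> {w. (u, w) \<in> parcs G}"
      using neighbours[OF u] by blast
    have adj: "(u, w) \<in> parcs G \<and> (w, u) \<in> parcs G \<and> w \<in> pverts G" if "w \<in> N" for w
    proof -
      have "(u, w) \<in> parcs G" using N that by blast
      then show ?thesis using sym[of u w] arc_snd_in_verts[of "(u, w)"] by simp
    qed
    have card: "card (Some ` N) = k" using N by (simp add: card_image)
    have spokes: "(Some u, None) \<in> parcs (join_vertex G)" "(None, Some u) \<in> parcs (join_vertex G)"
      using u by simp_all
    have common: "(Some u, x) \<in> parcs (join_vertex G)" "(x, Some u) \<in> parcs (join_vertex G)"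
      "(None, x) \<in> parcs (join_vertex G)" "(x, None) \<in> parcs (join_vertex G)" "x \<in> dom c"
      if "x \<in> Some ` N" for x
      using that adj unfolding dom pverts_join_vertex by auto
    have "finite (Some ` N)" using N(1) by simp
    then show "\<exists>P. proper_path_family (join_vertex G) c (Some u) None P \<and> card P = Suc k"
      "\<exists>P. proper_path_family (join_vertex G) c None (Some u) P \<and> card P = Suc k"
      using join.proper_path_family_common_neighbours[OF spokes(1), of "Some ` N" c]
        join.proper_path_family_common_neighbours[OF spokes(2), of "Some ` N" c] common
      unfolding card by blast+
  qed
  fix x y assume xy: "x \<in> pverts (join_vertex G)" "y \<in> pverts (join_vertex G)" "x \<noteq> y"
  show "\<exists>P. proper_path_family (join_vertex G) c x y P \<and> card P = Suc k"
  proof (cases x)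
    case None
    then obtain u where "y = Some u" "u \<in> pverts G"
      using xy by (auto simp: pverts_join_vertex)
    then show ?thesis using None spoke_out by simp
  next
    case x: (Some u)
    show ?thesis
    proof (cases y)
      case None
      moreover have "u \<in> pverts G" using xy x by (auto simp: pverts_join_vertex)
      ultimately show ?thesis using x spoke_in by simp
    next
      case y: (Some v)
      have uv: "u \<in> pverts G" "v \<in> pverts G" "u \<noteq> v"
        using xy x y by (auto simp: pverts_join_vertex)
      then obtain P where "proper_path_family G (c \<circ> Some) u v P" "card P = k"
        using conn by (auto simp: proper_vertex_connected_iff)
      moreover have "None \<in> dom c" unfolding dom pverts_join_vertex by simp
      ultimately show ?thesis
        using proper_path_family_through_hub[of c u v P] uv unfolding x y by blast
    qed
  qed
qed

lemma vertex_coloring_comp_Some: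
  assumes "vertex_coloring (join_vertex G) m c"
  shows "vertex_coloring G m (c \<circ> Some)"
proof -
  have "dom (c \<circ> Some) = Some -` dom c" by auto
  moreover have "ran (c \<circ> Some) \<subseteq> ran c" by (auto simp: ran_def)
  ultimately show ?thesis
    using assms by (auto simp: vertex_coloring_def pverts_join_vertex)
qed

text \<open>The hub takes color 0, which is available exactly because \<open>0 < m\<close>.\<close>

lemma vertex_coloring_case_option:
  assumes "vertex_coloring G m c" "0 < m"
  shows "vertex_coloring (join_vertex G) m (case_option (Some 0) c)"
proof -
  have "dom (case_option (Some 0) c) = insert None (Some ` dom c)"
    by (intro set_eqI; case_tac x) auto
  moreover have "ran (case_option (Some 0) c) = insert 0 (ran c)"
    by (auto simp: ran_def split: option.splits)
  ultimately show ?thesis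
    using assms by (auto simp: vertex_coloring_def pverts_join_vertex)
qed

theorem pvc_k_join_vertex:
  assumes degree: "\<And>u. u \<in> pverts G \<Longrightarrow> k \<le> card {w. (u, w) \<in> parcs G}"
    and nonadjacent: "a \<in> pverts G" "b \<in> pverts G" "a \<noteq> b" "(a, b) \<notin> parcs G"
    and "0 < k"
  shows "pvc_k (Suc k) (join_vertex G) = pvc_k k G"
proof -
  \<comment> \<open>The same numbers \<open>m\<close> are admissible on both sides, so the two
    \<open>LEAST\<close> terms agree without any argument that a minimum is attained.\<close>
  have "(\<exists>c. vertex_coloring (join_vertex G) m c \<and>
          proper_vertex_connected (Suc k) (join_vertex G) c) \<longleftrightarrow>
        (\<exists>c. vertex_coloring G m c \<and> proper_vertex_connected k G c)" (is "?L \<longleftrightarrow> ?R") for m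
  proof
    assume ?L
    then show ?R
      using vertex_coloring_comp_Some proper_vertex_connected_join_vertex by blast
  next
    assume ?R
    then obtain c where c: "vertex_coloring G m c" "proper_vertex_connected k G c" by blast
    let ?c = "case_option (Some 0) c"
    \<comment> \<open>An uncolored hub could not carry the additional path; the nonadjacent pair
      \<open>a\<close>, \<open>b\<close> rules this case out.\<close>
    have "m \<noteq> 0"
      using c not_proper_vertex_connected_uncolored[OF nonadjacent \<open>0 < k\<close>]
      by (cases "m = 0") (simp_all add: vertex_coloring_0)
    then have col: "vertex_coloring (join_vertex G) m ?c"
      using vertex_coloring_case_option c by blast
    have "?c \<circ> Some = c" by (simp add: fun_eq_iff)
    then have "proper_vertex_connected (Suc k) (join_vertex G) ?c"
      using c degree col \<open>m \<noteq> 0\<close>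
      by (intro proper_vertex_connected_join_vertexI) (auto simp: vertex_coloring_def)
    then show ?L using col by blast
  qed
  then show ?thesis by (simp add: pvc_k_def)
qed

text \<open>This is not the case \<open>k = 0\<close> of \<open>pvc_k_join_vertex\<close>: empty
  families in \<open>G\<close> need no color, whereas a nonadjacent pair of the join needs one. One
  color suffices, as every pair is joined by an edge or by the two-edge path through the
  hub.\<close>

theorem pvc_join_vertex:
  assumes nonadjacent: "a \<in> pverts G" "b \<in> pverts G" "a \<noteq> b" "(a, b) \<notin> parcs G"
  shows "pvc (join_vertex G) = 1"
proof (rule pvc_k_eq_1[OF _ vertex_coloring_constant])
  let ?c = "constant_coloring (join_vertex G)"
  show "\<not> proper_vertex_connected 1 (join_vertex G) Map.empty"
    by (rule not_proper_vertex_connected_uncolored[of "Some a" _ "Some b"])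
      (use nonadjacent in \<open>auto simp: pverts_join_vertex\<close>)
  show "proper_vertex_connected 1 (join_vertex G) ?c"
    unfolding proper_vertex_connected_iff
  proof (intro ballI impI)
    fix x y assume xy: "x \<in> pverts (join_vertex G)" "y \<in> pverts (join_vertex G)" "x \<noteq> y"
    show "\<exists>P. proper_path_family (join_vertex G) ?c x y P \<and> card P = 1"
    proof (cases "(x, y) \<in> parcs (join_vertex G)")
      case True
      then have "proper_path_family (join_vertex G) ?c x y {[x, y]}"
        by (rule join.proper_path_family_edge)
      then show ?thesis by (intro exI[of _ "{[x, y]}"]) simp
    next
      case False
      \<comment> \<open>The hub is adjacent to all other vertices, so a nonadjacent pair lies in
        \<open>G\<close>. Its path through the hub arises by extending the empty family.\<close>
      then obtain u v where uv: "x = Some u" "y = Some v" "u \<in> pverts G" "v \<in> pverts G" "u \<noteq> v"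
        using xy by (auto simp: pverts_join_vertex)
      have "proper_path_family G (?c \<circ> Some) u v {}"
        by (simp add: proper_path_family_def disjoint_paths_def)
      from proper_path_family_through_hub[OF this uv(3-5)] show ?thesis
        using uv by (auto simp: dom_constant_coloring pverts_join_vertex)
    qed
  qed
qed

end

section \<open>Cycles and wheels\<close>

lemma cycle_graph_degree:
  assumes "3 \<le> n" "i \<in> pverts (cycle_graph n)"
  shows "2 \<le> card {w. (i, w) \<in> parcs (cycle_graph n)}"
proof -
  interpret pair_graph "cycle_graph n" using assms by (intro pair_graph_cycle_graph)
  \<comment> \<open>The successor and the predecessor of \<open>i\<close> on the cycle, with the
    wrap-around written out; they differ because 3 \<le> \<open>n\<close>.\<close>
  let ?s = "if Suc i = n then 0 else Suc i" and ?p = "if i = 0 then n - 1 else i - 1"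
  have "{?s, ?p} \<subseteq> {w. (i, w) \<in> parcs (cycle_graph n)}"
    using assms by (auto simp: cycle_graph_def)
  moreover have "finite {w. (i, w) \<in> parcs (cycle_graph n)}"
    by (rule finite_subset[OF _ pair_finite_verts]) (auto dest: arc_snd_in_verts)
  moreover have "card {?s, ?p} = 2"
    using assms by (auto simp: card_insert_if)
  ultimately show ?thesis by (metis card_mono)
qed

text \<open>In the triangle the successor of 2 wraps around to 0; from \<open>n = 4\<close> on this
  no longer happens.\<close>

lemma cycle_graph_nonadjacent:
  assumes "4 \<le> n"
  shows "0 \<in> pverts (cycle_graph n)" "2 \<in> pverts (cycle_graph n)"
    "(0, 2) \<notin> parcs (cycle_graph n)"
  using assms by (auto simp: cycle_graph_def)

text \<open>\<open>cycle_graph 3\<close> is a triangle, and joining a vertex to it gives the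
  complete graph on four vertices.\<close>

lemma wheel_graph_3_complete:
  assumes "u \<in> pverts (wheel_graph 3)" "v \<in> pverts (wheel_graph 3)" "u \<noteq> v"
  shows "(u, v) \<in> parcs (wheel_graph 3)"
proof -
  have "{0..<3} = {0, 1, 2 :: nat}" by auto
  then show ?thesis
    using assms by (auto simp: wheel_graph_def pverts_join_vertex cycle_graph_def)
qed

text \<open>For \<open>n = 3\<close> this supplies the bound \<open>k < card (pverts G)\<close> of
  \<open>pvc_k_complete\<close>, which is tight at \<open>k = 3\<close>.\<close>

lemma card_pverts_wheel_graph: "card (pverts (wheel_graph n)) = Suc n"
  by (simp add: wheel_graph_def pverts_join_vertex cycle_graph_def card_image card_insert_if image_iff)

theorem theorem3:
  shows "(pvc (wheel_graph 3) = 0 \<and> (\<forall>n\<ge>4. pvc (wheel_graph n) = 1))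
    \<and> (pvc_k 2 (wheel_graph 3) = 1 \<and> (\<forall>n\<ge>4. pvc_k 2 (wheel_graph n) = pvc (cycle_graph n)))
    \<and> (pvc_k 3 (wheel_graph 3) = 1 \<and> (\<forall>n\<ge>4. pvc_k 3 (wheel_graph n) = pvc_k 2 (cycle_graph n)))"
proof -
  interpret W3: pair_graph "wheel_graph 3" by (rule pair_graph_wheel_graph) simp
  have W3: "pvc (wheel_graph 3) = 0" "pvc_k 2 (wheel_graph 3) = 1" "pvc_k 3 (wheel_graph 3) = 1"
    using W3.pvc_complete W3.pvc_k_complete wheel_graph_3_complete card_pverts_wheel_graph[of 3]
    by simp_all
  have Wn: "pvc (wheel_graph n) = 1"
    "pvc_k 2 (wheel_graph n) = pvc (cycle_graph n)"
    "pvc_k 3 (wheel_graph n) = pvc_k 2 (cycle_graph n)" if n: "4 \<le> n" for n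
  proof -
    interpret C: pair_graph "cycle_graph n" using n by (intro pair_graph_cycle_graph) simp
    note nonadj = cycle_graph_nonadjacent(1,2)[OF n] zero_neq_numeral cycle_graph_nonadjacent(3)[OF n]
    \<comment> \<open>Two neighbours per vertex cover \<open>k = 1\<close> and \<open>k = 2\<close>,
      which are the instances behind (b) and (c).\<close>
    have degree: "k \<le> card {w. (i, w) \<in> parcs (cycle_graph n)}"
      if "i \<in> pverts (cycle_graph n)" "k \<le> 2" for i k
      using cycle_graph_degree[of n i] n that by simp
    show "pvc (wheel_graph n) = 1"
      unfolding wheel_graph_def by (rule C.pvc_join_vertex[OF nonadj])
    show "pvc_k 2 (wheel_graph n) = pvc (cycle_graph n)"
      "pvc_k 3 (wheel_graph n) = pvc_k 2 (cycle_graph n)"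
      using C.pvc_k_join_vertex[OF degree nonadj, of 1] C.pvc_k_join_vertex[OF degree nonadj, of 2]
      by (simp_all add: wheel_graph_def numeral_eq_Suc)
  qed
  show ?thesis using W3 Wn by blast
qed

end
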